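(* Let $G=K_{l_1*t_1,\dots,l_s*t_s}$ be a complete multipartite graph with at least $9$ vertices, where $t_1>t_2>\cdots>t_s\ge 1$ and $l_1,\dots,l_s\ge 1$. Then there exists a switching $\sigma$ of $G$ such that all eigenvalues of the signed graph $G^{\sigma}$ are main.
   Context: $K_{l_1*t_1,\dots,l_s*t_s}$ denotes the complete multipartite graph having, for each $i$, exactly $l_i$ parts of size $t_i$ (vertices are adjacent iff they lie in different parts). A signed graph $(G,\sigma)$ is a graph with a sign function $\sigma:E(G)\to\{\pm1\}$; its adjacency matrix has entry $\sigma(v_iv_j)$ for adjacent $v_i,v_j$ and $0$ otherwise, and its eigenvalues are those of this matrix. For $X\subseteq V(G)$, the switching of $G$ about $X$ is the signed graph $G^\sigma$ in which exactly the edges between $X$ and $V(G)\setminus X$ are negative. An eigenvalue is main if it has an eigenvector whose entries have nonzero sum. *)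

theory Defs
  imports
    "HOL-Library.Disjoint_Sets"
    "HOL-Library.Multiset"
    "Jordan_Normal_Form.Char_Poly"
begin

text \<open>
  A finite simple graph is given by its vertex set and its edge set, an edge being a
  two-element set of vertices. A sign function assigns a real number to each edge; its values
  off the edge set are irrelevant.
\<close>

text \<open>The predicate says that \<open>(V, E)\<close> is a copy of \<open>K\<^bsub>l\<^sub>1*t\<^sub>1, \<dots>, l\<^sub>s*t\<^sub>s\<^esub>\<close>: the
  multiset of part sizes contains each \<open>t i\<close> exactly \<open>l i\<close> times, for \<open>i = 1, \<dots>, s\<close>.\<close>

definition complete_multipartite ::
    "'v set \<Rightarrow> 'v set set \<Rightarrow> nat \<Rightarrow> (nat \<Rightarrow> nat) \<Rightarrow> (nat \<Rightarrow> nat) \<Rightarrow> bool" where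
  "complete_multipartite V E s l t \<longleftrightarrow>
     finite V \<and>
     (\<exists>P. partition_on V P \<and>
          image_mset card (mset_set P) = (\<Sum>i\<in>{1..s}. replicate_mset (l i) (t i)) \<and>
          E = {{u, v} | u v. \<exists>B\<in>P. \<exists>C\<in>P. B \<noteq> C \<and> u \<in> B \<and> v \<in> C})"

definition switching_sign :: "'v set \<Rightarrow> 'v set \<Rightarrow> real" where
  "switching_sign X e = (if e \<inter> X \<noteq> {} \<and> e - X \<noteq> {} then -1 else 1)"

text \<open>The list \<open>vs\<close> enumerates the vertices without repetition and fixes the order of the
  rows and columns.\<close>

definition signed_adj_matrix :: "'v list \<Rightarrow> 'v set set \<Rightarrow> ('v set \<Rightarrow> real) \<Rightarrow> real mat" where
  "signed_adj_matrix vs E \<sigma> =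
     mat (length vs) (length vs)
       (\<lambda>(i, j). if {vs ! i, vs ! j} \<in> E then \<sigma> {vs ! i, vs ! j} else 0)"

definition main_eigenvalue :: "real mat \<Rightarrow> real \<Rightarrow> bool" where
  "main_eigenvalue A k \<longleftrightarrow> (\<exists>v. eigenvector A v k \<and> (\<Sum>i<dim_vec v. v $ i) \<noteq> 0)"

end

theory Submission
  imports Defs
begin

text \<open>
  Switching about \<open>X\<close> conjugates the adjacency matrix of \<open>G\<close> by the diagonal matrix of signs
  of \<open>X\<close>, so the switching works iff the sign vector of \<open>X\<close> is not orthogonal to any eigenspace
  of \<open>G\<close>. The eigenspaces are of three kinds: vectors with sum zero on every part (eigenvalue
  \<open>0\<close>), vectors constant on the parts and supported with sum zero on the parts of one size \<open>d\<close>
  (eigenvalue \<open>-d\<close>), and the lines spanned by \<open>1 / (k + |B|)\<close> on each part \<open>B\<close>, where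
  \<open>\<Sum>\<^sub>B |B| / (k + |B|) = 1\<close>. The first two kinds only require that \<open>X\<close> splits some part and
  meets the parts of each repeated size unevenly. For the third, there are at most as many such
  \<open>k\<close> as there are distinct part sizes; if \<open>X\<close> is varied only inside the parts of one size,
  each \<open>k\<close> excludes at most one value of the number of vertices chosen there. With at least nine
  vertices some size class leaves more admissible values than there are distinct sizes.
\<close>

section \<open>Eigenvectors of a complete multipartite graph as functions on the vertices\<close>

locale vertex_partition =
  fixes V :: "'v set" and P :: "'v set set"
  assumes finite_V: "finite V" and part: "partition_on V P"
begin

definition eigenfunction :: "('v \<Rightarrow> real) \<Rightarrow> real \<Rightarrow> bool" where
  "eigenfunction x k \<longleftrightarrow> (\<forall>B\<in>P. \<forall>u\<in>B. sum x V - sum x B = k * x u)"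

definition switch :: "'v set \<Rightarrow> 'v \<Rightarrow> real" where
  "switch X v = (if v \<in> X then -1 else 1)"

definition part_of :: "'v \<Rightarrow> 'v set" where
  "part_of u = \<Union>{B\<in>P. u \<in> B}"

definition sizes :: "nat set" where
  "sizes = card ` P"

definition size_class :: "nat \<Rightarrow> 'v set set" where
  "size_class d = {B\<in>P. card B = d}"

text \<open>These are the main eigenvalues of the unswitched graph. The poles are excluded
  explicitly because division by zero yields \<open>0\<close>.\<close>

definition secular_roots :: "real set" where
  "secular_roots = {k. (\<forall>B\<in>P. k + card B \<noteq> 0) \<and> (\<Sum>B\<in>P. card B / (k + card B)) = 1}"

text \<open>The inner product of the sign vector of \<open>X\<close> with the function equal to
  \<open>1 / (k + card B)\<close> on each part \<open>B\<close>.\<close>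

definition switched_secular :: "'v set \<Rightarrow> real \<Rightarrow> real" where
  "switched_secular X k = (\<Sum>B\<in>P. (real (card B) - 2 * real (card (X \<inter> B))) / (k + card B))"

section \<open>Parts and sums over them\<close>

lemma finite_P: "finite P"
  using finite_V part finite_elements by blast

lemma Union_P: "\<Union>P = V"
  using part by (simp add: partition_on_def)

lemma finite_part: "B \<in> P \<Longrightarrow> finite B"
  using finite_V Union_P by (meson Union_upper finite_subset)

lemma part_nonempty: "B \<in> P \<Longrightarrow> B \<noteq> {}"
  using part by (auto simp: partition_on_def)

lemma card_part_pos: "B \<in> P \<Longrightarrow> card B > 0"
  using part_nonempty finite_part by (simp add: card_gt_0_iff)

lemma parts_disjoint: "B \<in> P \<Longrightarrow> C \<in> P \<Longrightarrow> B \<noteq> C \<Longrightarrow> B \<inter> C = {}"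
  using part by (auto simp: partition_on_def disjoint_def)

lemma part_unique: "B \<in> P \<Longrightarrow> C \<in> P \<Longrightarrow> u \<in> B \<Longrightarrow> u \<in> C \<Longrightarrow> B = C"
  using parts_disjoint by blast

lemma part_of_eq: "B \<in> P \<Longrightarrow> u \<in> B \<Longrightarrow> part_of u = B"
  using part_unique unfolding part_of_def by blast

lemma sum_Union_parts:
  assumes "Q \<subseteq> P" shows "sum f (\<Union>Q) = (\<Sum>B\<in>Q. sum f B)"
proof -
  have "sum f (\<Union>Q) = (sum \<circ> sum) f Q"
    by (rule sum.Union_disjoint) (use assms finite_part parts_disjoint in blast)+
  then show ?thesis by simp
qed

lemma sum_V: "sum f V = (\<Sum>B\<in>P. sum f B)"
  using sum_Union_parts[of P f] Union_P by simp

lemma card_Union_parts: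
  assumes "Q \<subseteq> P" "Z \<subseteq> \<Union>Q" shows "card Z = (\<Sum>B\<in>Q. card (Z \<inter> B))"
proof -
  have fin: "finite (\<Union>Q)"
    using assms(1) finite_V Union_P by (metis Union_mono finite_subset)
  have "card Z = (\<Sum>v\<in>\<Union>Q. if v \<in> Z then 1 else 0)"
    using assms(2) fin by (simp add: sum.If_cases Int_absorb1)
  also have "\<dots> = (\<Sum>B\<in>Q. \<Sum>v\<in>B. if v \<in> Z then 1 else 0)"
    by (rule sum_Union_parts[OF assms(1)])
  also have "\<dots> = (\<Sum>B\<in>Q. card (Z \<inter> B))"
    by (rule sum.cong) (use assms finite_part in \<open>auto simp: sum.If_cases Int_commute\<close>)
  finally show ?thesis .
qed

section \<open>Sufficient conditions for all eigenvalues to be main\<close>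

lemma sum_switch:
  assumes "B \<in> P" shows "(\<Sum>v\<in>B. switch X v) = real (card B) - 2 * real (card (X \<inter> B))"
proof -
  have "(\<Sum>v\<in>B. switch X v) = (\<Sum>v\<in>B. 1 - 2 * (if v \<in> X then 1 else 0))"
    by (rule sum.cong) (auto simp: switch_def)
  also have "\<dots> = real (card B) - 2 * (\<Sum>v\<in>B. if v \<in> X then 1 else 0)"
    by (simp add: sum_subtractf sum_distrib_left)
  also have "(\<Sum>v\<in>B. if v \<in> X then 1 else 0::real) = card (X \<inter> B)"
    using finite_part[OF assms] by (simp add: sum.If_cases Int_commute)
  finally show ?thesis .
qed

text \<open>Multiplying by \<open>switch X\<close> carries eigenfunctions of the graph to
  eigenvectors of the switched graph, so the sum in the conclusion is the entry sum of such an
  eigenvector. The witness \<open>y\<close> may differ from \<open>x\<close>; each hypothesis on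
  \<open>X\<close> serves one kind of eigenspace.\<close>

lemma all_eigenvalues_main:
  assumes nonconst: "\<And>B. B \<in> P \<Longrightarrow> card B \<ge> 2 \<Longrightarrow> \<exists>C\<in>P. C \<inter> X \<noteq> {} \<and> C - X \<noteq> {}"
    and unequal: "\<And>B C. B \<in> P \<Longrightarrow> C \<in> P \<Longrightarrow> B \<noteq> C \<Longrightarrow> card B = card C \<Longrightarrow>
      \<exists>B'\<in>size_class (card B). \<exists>C'\<in>size_class (card B). card (X \<inter> B') \<noteq> card (X \<inter> C')"
    and secular: "\<And>k. k \<in> secular_roots \<Longrightarrow> switched_secular X k \<noteq> 0"
    and eig: "eigenfunction x k" and nz: "w \<in> V" "x w \<noteq> 0"
  shows "\<exists>y. eigenfunction y k \<and> (\<Sum>v\<in>V. switch X v * y v) \<noteq> 0"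
proof -
  define T where "T = sum x V"
  have ev: "T - sum x B = k * x u" if "B \<in> P" "u \<in> B" for B u
    using eig that by (auto simp: eigenfunction_def T_def)
  \<comment> \<open>Summing the eigenvalue equation over \<open>B\<close> leaves a relation between
    the part sums and the total alone.\<close>
  have evB: "(k + card B) * sum x B = card B * T" if "B \<in> P" for B
  proof -
    have "(\<Sum>u\<in>B. T - sum x B) = (\<Sum>u\<in>B. k * x u)"
      by (rule sum.cong) (use ev that in auto)
    then have "card B * (T - sum x B) = k * sum x B" by (simp add: sum_distrib_left)
    then show ?thesis by (simp add: algebra_simps)
  qed
  obtain W where W: "W \<in> P" "w \<in> W" using nz Union_P by blast
  \<comment> \<open>By \<open>evB\<close>, a nonzero total determines all part sums; with total
    zero, a part sum can be nonzero only if \<open>k = - card B\<close>.\<close>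
  consider (secular) "T \<noteq> 0" | (zero) "T = 0" "k = 0" | (balanced) "T = 0" "k \<noteq> 0" by blast
  then show ?thesis
  proof cases
    case secular
    have kB: "k + card B \<noteq> 0" if "B \<in> P" for B
      using evB[OF that] secular card_part_pos[OF that] by auto
    have SB: "sum x B = T * (card B / (k + card B))" if "B \<in> P" for B
      using evB[OF that] kB[OF that] by (simp add: field_simps)
    have "T = (\<Sum>B\<in>P. T * (card B / (k + card B)))"
      unfolding T_def sum_V[of x] by (rule sum.cong) (simp_all add: SB T_def sum_V[of x])
    then have "T * (\<Sum>B\<in>P. card B / (k + card B)) = T * 1" by (simp add: sum_distrib_left)
    then have one: "(\<Sum>B\<in>P. card B / (k + card B)) = 1" using secular by simp
    then have "k \<in> secular_roots" using kB by (simp add: secular_roots_def)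
    then have sw: "switched_secular X k \<noteq> 0" by (rule assms(3))
    \<comment> \<open>The equation fixes only \<open>k * x u\<close>, which says nothing about
      \<open>x\<close> when \<open>k = 0\<close>. Hence an eigenfunction is written down directly,
      normalised to total sum 1.\<close>
    define y where "y u = 1 / (k + card (part_of u))" for u
    have y: "y u = 1 / (k + card B)" if "B \<in> P" "u \<in> B" for B u
      using that by (simp add: y_def part_of_eq)
    have yB: "sum y B = card B / (k + card B)" if "B \<in> P" for B
      using y[OF that] by simp
    have "sum y V = 1" using one yB sum_V[of y] by simp
    then have "sum y V - sum y B = k * y u" if "B \<in> P" "u \<in> B" for B u
      using that by (simp add: yB y kB field_simps)
    then have "eigenfunction y k" by (simp add: eigenfunction_def)
    moreover have "(\<Sum>v\<in>V. switch X v * y v) = switched_secular X k"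
    proof -
      have "(\<Sum>v\<in>B. switch X v * y v) = (real (card B) - 2 * real (card (X \<inter> B))) / (k + card B)"
        if "B \<in> P" for B
      proof -
        have "(\<Sum>v\<in>B. switch X v * y v) = (\<Sum>v\<in>B. switch X v) / (k + card B)"
          using y[OF that] by (simp add: sum_divide_distrib)
        then show ?thesis using sum_switch[OF that] by simp
      qed
      then show ?thesis by (simp add: switched_secular_def sum_V)
    qed
    ultimately show ?thesis using sw by auto
  next
    case zero
    have "sum x W = 0" using ev W zero by simp
    \<comment> \<open>A zero sum with \<open>x w\<close> nonzero forces a second vertex in
      \<open>W\<close>, which makes \<open>nonconst\<close> applicable.\<close>
    then have "\<not> W \<subseteq> {w}" using nz W by (auto simp: subset_singleton_iff)
    then obtain w' where "w' \<in> W" "w' \<noteq> w" by blast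
    then have "card {w, w'} \<le> card W" using W finite_part by (intro card_mono) auto
    then have "card W \<ge> 2" using \<open>w' \<noteq> w\<close> by auto
    then obtain C p q where C: "C \<in> P" "p \<in> C" "p \<in> X" "q \<in> C" "q \<notin> X"
      using nonconst[OF W(1)] by blast
    \<comment> \<open>Two vertices of one part on different sides of \<open>X\<close>: the
      difference of their indicators has sum zero on every part, but the signs do not
      cancel.\<close>
    define y :: "'v \<Rightarrow> real" where "y u = (if u = p then 1 else 0) - (if u = q then 1 else 0)" for u
    have yB: "sum y B = 0" if "B \<in> P" for B
    proof -
      have "p \<in> B \<longleftrightarrow> q \<in> B" using C that part_unique by metis
      then show ?thesis using finite_part[OF that] by (simp add: y_def sum_subtractf)
    qed
    then have "eigenfunction y k" using zero sum_V[of y] by (simp add: eigenfunction_def)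
    moreover have "(\<Sum>v\<in>V. switch X v * y v) = -2"
    proof -
      have "(\<Sum>v\<in>V. switch X v * y v)
        = (\<Sum>v\<in>V. (if v = p then switch X v else 0) - (if v = q then switch X v else 0))"
        by (rule sum.cong) (auto simp: y_def)
      also have "\<dots> = switch X p - switch X q"
        using C Union_P finite_V by (auto simp: sum_subtractf)
      finally show ?thesis using C by (simp add: switch_def)
    qed
    ultimately show ?thesis by fastforce
  next
    case balanced
    have "sum x W \<noteq> 0" using ev[OF W] balanced nz by auto
    then have kW: "k + card W = 0" using evB[OF W(1)] balanced by simp
    \<comment> \<open>The part sums add up to zero, so a second part has nonzero sum too; both sizes
      then equal \<open>-k\<close>.\<close>
    have "sum x W + sum (sum x) (P - {W}) = 0"
      using balanced sum_V[of x] T_def sum.remove[OF finite_P W(1), of "sum x"] by simp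
    then have "sum (sum x) (P - {W}) \<noteq> 0" using \<open>sum x W \<noteq> 0\<close> by simp
    then obtain C where C: "C \<in> P" "C \<noteq> W" "sum x C \<noteq> 0"
      by (metis Diff_iff insertCI sum.not_neutral_contains_not_neutral)
    then have "k + card C = 0" using evB[OF C(1)] balanced by simp
    then have "card W = card C" using kW by simp
    then obtain B' C' where *: "B' \<in> P" "C' \<in> P" "card B' = card W" "card C' = card W"
      "card (X \<inter> B') \<noteq> card (X \<inter> C')"
      using unequal[OF W(1) C(1)] C(2) by (auto simp: size_class_def)
    \<comment> \<open>The difference of the indicators of two equally large parts is an
      eigenfunction for minus their size; its signed sum measures how unevenly \<open>X\<close>
      meets them.\<close>
    define y :: "'v \<Rightarrow> real" where "y u = (if u \<in> B' then 1 else 0) - (if u \<in> C' then 1 else 0)" for u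
    have y: "y u = (if B = B' then 1 else 0) - (if B = C' then 1 else 0)" if "B \<in> P" "u \<in> B" for B u
      using that *(1,2) part_unique[of B B' u] part_unique[of B C' u] by (auto simp: y_def)
    have yB: "sum y B = real (card W) * ((if B = B' then 1 else 0) - (if B = C' then 1 else 0))"
      if "B \<in> P" for B
    proof -
      have "sum y B = (\<Sum>u\<in>B. (if B = B' then 1 else 0) - (if B = C' then 1 else 0))"
        by (rule sum.cong) (use y that in auto)
      then show ?thesis using *(3,4) by (cases "B = B'"; cases "B = C'") simp_all
    qed
    have "sum y V = 0"
      unfolding sum_V using * finite_P by (simp add: yB sum_distrib_left[symmetric] sum_subtractf)
    moreover have "k = - real (card W)" using kW by simp
    ultimately have "eigenfunction y k" using yB y by (simp add: eigenfunction_def)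
    moreover have "(\<Sum>v\<in>V. switch X v * y v) = (\<Sum>v\<in>B'. switch X v) - (\<Sum>v\<in>C'. switch X v)"
    proof -
      have sub: "B' \<subseteq> V" "C' \<subseteq> V" using * Union_P by auto
      have "(\<Sum>v\<in>V. switch X v * y v)
        = (\<Sum>v\<in>V. (if v \<in> B' then switch X v else 0) - (if v \<in> C' then switch X v else 0))"
        by (rule sum.cong) (auto simp: y_def)
      also have "\<dots> = (\<Sum>v\<in>B'. switch X v) - (\<Sum>v\<in>C'. switch X v)"
        using sub finite_V by (simp add: sum_subtractf sum.If_cases Int_absorb1)
      finally show ?thesis .
    qed
    ultimately show ?thesis using * by (auto simp: sum_switch)
  qed
qed

section \<open>Counting the secular roots\<close>

lemma finite_sizes: "finite sizes"
  using finite_P by (simp add: sizes_def)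

lemma sum_over_classes:
  fixes g :: "'v set \<Rightarrow> 'b::comm_monoid_add"
  shows "(\<Sum>B\<in>P. g B) = (\<Sum>d\<in>sizes. \<Sum>B\<in>size_class d. g B)"
  unfolding sizes_def size_class_def
  by (rule sum.group[symmetric]) (use finite_P in auto)

text \<open>Parts of equal size share a denominator, so clearing denominators gives a nonzero
  polynomial whose degree is the number of distinct sizes, not of parts.\<close>

lemma finite_card_secular_roots:
  assumes "P \<noteq> {}"
  shows "finite secular_roots" "card secular_roots \<le> card sizes"
proof -
  \<comment> \<open>\<open>n d\<close> counts the vertices in parts of size \<open>d\<close>,
    \<open>q sizes\<close> is the common denominator, and \<open>p\<close> is the secular equation
    multiplied by it.\<close>
  define n where "n d = real d * real (card (size_class d))" for d
  define q :: "nat set \<Rightarrow> real poly" where "q D = (\<Prod>e\<in>D. [:real e, 1:])" for D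
  define p where "p = q sizes - (\<Sum>d\<in>sizes. Polynomial.smult (n d) (q (sizes - {d})))"
  have degq: "degree (q D) = card D" and leadq: "coeff (q D) (card D) = 1" if "finite D" for D
  proof -
    show *: "degree (q D) = card D"
      unfolding q_def by (subst degree_prod_eq_sum_degree) auto
    have "lead_coeff (q D) = 1" unfolding q_def by (subst lead_coeff_prod) auto
    then show "coeff (q D) (card D) = 1" using * by simp
  qed
  have "sizes \<noteq> {}" using assms by (simp add: sizes_def)
  then have pos: "card sizes > 0" using finite_sizes by (simp add: card_gt_0_iff)
  have small: "degree (\<Sum>d\<in>sizes. Polynomial.smult (n d) (q (sizes - {d}))) < card sizes"
  proof (rule degree_sum_less[OF _ pos])
    fix d assume "d \<in> sizes"
    have "degree (Polynomial.smult (n d) (q (sizes - {d}))) \<le> degree (q (sizes - {d}))"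
      by (rule degree_smult_le)
    also have "\<dots> = card (sizes - {d})" using degq finite_sizes by simp
    also have "\<dots> < card sizes" using \<open>d \<in> sizes\<close> finite_sizes by (intro psubset_card_mono) auto
    finally show "degree (Polynomial.smult (n d) (q (sizes - {d}))) < card sizes" .
  qed
  \<comment> \<open>Each subtracted term lacks one linear factor, so the leading coefficient of
    \<open>q sizes\<close> survives.\<close>
  then have "coeff p (card sizes) = 1"
    using leadq[OF finite_sizes] by (simp add: p_def coeff_eq_0)
  then have p0: "p \<noteq> 0" by auto
  have degp: "degree p \<le> card sizes"
    unfolding p_def using small degq[OF finite_sizes] by (intro degree_diff_le) auto
  have sub: "secular_roots \<subseteq> {k. poly p k = 0}"
  proof
    fix k assume "k \<in> secular_roots"
    then have k: "\<And>d. d \<in> sizes \<Longrightarrow> k + real d \<noteq> 0"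
      and one: "(\<Sum>B\<in>P. card B / (k + card B)) = 1"
      by (auto simp: secular_roots_def sizes_def)
    have "(\<Sum>B\<in>P. card B / (k + card B)) = (\<Sum>d\<in>sizes. n d / (k + d))"
      unfolding sum_over_classes by (rule sum.cong) (auto simp: size_class_def n_def)
    then have one': "(\<Sum>d\<in>sizes. n d / (k + d)) = 1" using one by simp
    have "poly (Polynomial.smult (n d) (q (sizes - {d}))) k = poly (q sizes) k * (n d / (k + d))"
      if "d \<in> sizes" for d
    proof -
      have "q sizes = [:real d, 1:] * q (sizes - {d})"
        unfolding q_def by (rule prod.remove[OF finite_sizes that])
      then show ?thesis using k[OF that] by (simp add: field_simps)
    qed
    then have "(\<Sum>d\<in>sizes. poly (Polynomial.smult (n d) (q (sizes - {d}))) k)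
        = (\<Sum>d\<in>sizes. poly (q sizes) k * (n d / (k + d)))"
      by (intro sum.cong) auto
    also have "\<dots> = poly (q sizes) k" unfolding sum_distrib_left[symmetric] one' by simp
    finally show "k \<in> {k. poly p k = 0}" by (simp add: p_def poly_sum)
  qed
  have fin: "finite {k. poly p k = 0}" by (rule poly_roots_finite[OF p0])
  then show "finite secular_roots" using sub by (rule rev_finite_subset)
  show "card secular_roots \<le> card sizes"
    using card_mono[OF fin sub] poly_roots_degree[OF p0] degp by linarith
qed

section \<open>Subsets of one size class with prescribed cardinality\<close>

text \<open>Fix a part \<open>C\<close> of a class with at least two parts. If \<open>y\<close>
  vertices fit outside \<open>C\<close>, choose them there: \<open>C\<close> is missed and some
  other part is met. Otherwise take everything outside \<open>C\<close> and fill up inside it: since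
  \<open>y\<close> is below the class total, \<open>C\<close> is not exhausted while the other parts
  are.\<close>

lemma unevenly_distributed_subset:
  assumes "y \<le> c * card (size_class c)"
    and "card (size_class c) \<ge> 2 \<longrightarrow> 0 < y \<and> y < c * card (size_class c)"
  obtains Z where "Z \<subseteq> \<Union>(size_class c)" "card Z = y"
    "card (size_class c) \<ge> 2 \<Longrightarrow> \<exists>B\<in>size_class c. \<exists>C\<in>size_class c. card (Z \<inter> B) \<noteq> card (Z \<inter> C)"
proof -
  let ?Q = "size_class c" and ?U = "\<Union>(size_class c)"
  have QP: "?Q \<subseteq> P" by (auto simp: size_class_def)
  have finU: "finite ?U" using QP finite_V Union_P by (metis Union_mono finite_subset)
  have cardU: "card ?U = c * card ?Q"
  proof -
    have "card ?U = (\<Sum>B\<in>?Q. card (?U \<inter> B))" by (rule card_Union_parts[OF QP]) simp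
    also have "\<dots> = (\<Sum>B\<in>?Q. c)"
    proof (rule sum.cong)
      fix B assume "B \<in> ?Q"
      then have "?U \<inter> B = B" by blast
      then show "card (?U \<inter> B) = c" using \<open>B \<in> ?Q\<close> by (simp add: size_class_def)
    qed simp
    finally show ?thesis by simp
  qed
  show thesis
  proof (cases "card ?Q \<ge> 2")
    case False
    obtain Z where "Z \<subseteq> ?U" "card Z = y"
      using obtain_subset_with_card_n[of y ?U] assms(1) cardU by auto
    then show thesis using False that by blast
  next
    case True
    then have y: "0 < y" "y < c * card ?Q" using assms(2) by auto
    have "card ?Q > 0" using True by simp
    then obtain C where C: "C \<in> ?Q" by fastforce
    have finC: "finite C" "C \<in> P" using C finite_part QP by auto
    have disj: "C \<inter> B = {}" if "B \<in> ?Q" "B \<noteq> C" for B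
      using that finC QP parts_disjoint by blast
    show thesis
    proof (cases "y \<le> card (?U - C)")
      case True
      obtain Z where Z: "Z \<subseteq> ?U - C" "card Z = y"
        using obtain_subset_with_card_n[OF True] by auto
      then have "Z \<noteq> {}" using y by auto
      then obtain B z where B: "B \<in> ?Q" "z \<in> B" "z \<in> Z" using Z by blast
      have "Z \<inter> C = {}" using Z by auto
      moreover have "card (Z \<inter> B) > 0"
        using B QP finite_part by (auto simp: card_gt_0_iff)
      ultimately have "card (Z \<inter> B) \<noteq> card (Z \<inter> C)" by simp
      moreover have "Z \<subseteq> ?U" using Z by blast
      ultimately show thesis using that[of Z] Z(2) B(1) C by blast
    next
      case False
      obtain Z where Z: "?U - C \<subseteq> Z" "Z \<subseteq> ?U" "card Z = y"
        using exists_subset_between[of "?U - C" y ?U] False y cardU finU by auto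
      have "\<not> C \<subseteq> Z"
      proof
        assume "C \<subseteq> Z"
        then have "Z = ?U" using Z by blast
        then show False using Z y cardU by simp
      qed
      then have less: "card (Z \<inter> C) < c"
        using psubset_card_mono[OF finC(1), of "Z \<inter> C"] C by (auto simp: size_class_def)
      have "\<not> ?Q \<subseteq> {C}" using \<open>card ?Q \<ge> 2\<close> card_mono[of "{C}" ?Q] by auto
      then obtain B where B: "B \<in> ?Q" "B \<noteq> C" by blast
      then have "Z \<inter> B = B" using Z disj[OF B] by blast
      then have "card (Z \<inter> B) = c" using B by (simp add: size_class_def)
      then have "card (Z \<inter> B) \<noteq> card (Z \<inter> C)" using less by simp
      then show thesis using that[of Z] Z(2,3) B(1) C by blast
    qed
  qed
qed

text \<open>If every part of the class were contained in \<open>Z\<close> or disjoint from it,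
  \<open>card Z\<close> would be a multiple of \<open>c\<close>.\<close>

lemma exists_mixed_part:
  assumes "Z \<subseteq> \<Union>(size_class c)" "\<not> c dvd card Z"
  shows "\<exists>B\<in>size_class c. B \<inter> Z \<noteq> {} \<and> B - Z \<noteq> {}"
proof (rule ccontr)
  assume no: "\<not> ?thesis"
  have "card Z = (\<Sum>B\<in>size_class c. card (Z \<inter> B))"
    by (rule card_Union_parts[OF _ assms(1)]) (auto simp: size_class_def)
  moreover have "c dvd card (Z \<inter> B)" if "B \<in> size_class c" for B
  proof (cases "B \<inter> Z = {}")
    case True then show ?thesis by (simp add: Int_commute)
  next
    case False
    then have "Z \<inter> B = B" using no that by blast
    then show ?thesis using that by (simp add: size_class_def)
  qed
  ultimately have "c dvd card Z" by (simp add: dvd_sum)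
  then show False using assms(2) by simp
qed

section \<open>Switching sets obtained by varying one size class\<close>

definition good :: "'v set \<Rightarrow> bool" where
  "good X \<longleftrightarrow> X \<subseteq> V \<and>
     ((\<exists>B\<in>P. card B \<ge> 2) \<longrightarrow> (\<exists>C\<in>P. C \<inter> X \<noteq> {} \<and> C - X \<noteq> {})) \<and>
     (\<forall>d. card (size_class d) \<ge> 2 \<longrightarrow>
        (\<exists>B\<in>size_class d. \<exists>C\<in>size_class d. card (X \<inter> B) \<noteq> card (X \<inter> C))) \<and>
     (\<forall>k\<in>secular_roots. switched_secular X k \<noteq> 0)"

lemma good_all_main:
  assumes "good X" "eigenfunction x k" "w \<in> V" "x w \<noteq> 0"
  shows "\<exists>y. eigenfunction y k \<and> (\<Sum>v\<in>V. switch X v * y v) \<noteq> 0"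
proof (rule all_eigenvalues_main[OF _ _ _ assms(2-4)])
  fix B C assume BC: "B \<in> P" "C \<in> P" "B \<noteq> C" "card B = card C"
  have "card {B, C} \<le> card (size_class (card B))"
    using BC finite_P by (intro card_mono) (auto simp: size_class_def)
  then have "card (size_class (card B)) \<ge> 2" using BC by simp
  then show "\<exists>B'\<in>size_class (card B). \<exists>C'\<in>size_class (card B). card (X \<inter> B') \<noteq> card (X \<inter> C')"
    using assms(1) by (simp add: good_def)
qed (use assms(1) in \<open>auto simp: good_def\<close>)

text \<open>Only the number \<open>y\<close> of vertices chosen in class \<open>c\<close> varies. At
  a secular root \<open>k\<close> the switched sum is affine in \<open>y\<close> with nonzero slope
  \<open>-2 / (k + c)\<close>, so \<open>k\<close> excludes at most one \<open>y\<close>, and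
  \<open>Ys\<close> has more elements than there are roots. The alternatives in \<open>mixed\<close>
  settle the splitting of a part: no part has two vertices, another class supplies a split part, or
  divisibility does.\<close>

lemma exists_good_varying_class:
  assumes c: "c \<in> sizes" and Ys: "finite Ys" "card Ys > card sizes"
    and le: "\<And>y. y \<in> Ys \<Longrightarrow> y \<le> c * card (size_class c)"
    and strict: "\<And>y. card (size_class c) \<ge> 2 \<Longrightarrow> y \<in> Ys \<Longrightarrow> 0 < y \<and> y < c * card (size_class c)"
    and mixed: "sizes = {1} \<or> (\<exists>e\<in>sizes. e \<noteq> c \<and> e \<ge> 2) \<or> (\<forall>y\<in>Ys. \<not> c dvd y)"
  shows "\<exists>X. good X"
proof -
  have "\<exists>r. \<exists>B\<in>P. card B = d \<and> r \<in> B" if "d \<in> sizes" for d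
    using that part_nonempty by (force simp: sizes_def)
  then obtain r where r: "\<And>d. d \<in> sizes \<Longrightarrow> \<exists>B\<in>P. card B = d \<and> r d \<in> B" by metis
  \<comment> \<open>One vertex from each other class: this singles out one part of that class, and
    splits that part if its size is at least 2.\<close>
  define X0 where "X0 = r ` (sizes - {c})"
  have rd: "r d \<in> B \<longleftrightarrow> card B = d \<and> r d \<in> B" if "d \<in> sizes" "B \<in> P" for d B
    using r[OF that(1)] that(2) part_unique by blast
  have X0_c: "X0 \<inter> B = {}" if "B \<in> size_class c" for B
    using that rd unfolding X0_def size_class_def by blast
  have X0_other: "X0 \<inter> B \<subseteq> {r d}" if "B \<in> size_class d" for B d
    using that rd unfolding X0_def size_class_def by blast
  have "\<exists>Z. Z \<subseteq> \<Union>(size_class c) \<and> card Z = y \<and> (card (size_class c) \<ge> 2 \<longrightarrow>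
      (\<exists>B\<in>size_class c. \<exists>C\<in>size_class c. card (Z \<inter> B) \<noteq> card (Z \<inter> C)))" if "y \<in> Ys" for y
    using unevenly_distributed_subset[of y c] le[OF that] strict[OF _ that] by metis
  then obtain Z where Z: "\<And>y. y \<in> Ys \<Longrightarrow> Z y \<subseteq> \<Union>(size_class c)" "\<And>y. y \<in> Ys \<Longrightarrow> card (Z y) = y"
    "\<And>y. y \<in> Ys \<Longrightarrow> card (size_class c) \<ge> 2 \<Longrightarrow>
      \<exists>B\<in>size_class c. \<exists>C\<in>size_class c. card (Z y \<inter> B) \<noteq> card (Z y \<inter> C)" by metis
  define X where "X y = X0 \<union> Z y" for y
  have X_c: "X y \<inter> B = Z y \<inter> B" if "B \<in> size_class c" for y B
    using X0_c[OF that] by (auto simp: X_def)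
  have X_other: "X y \<inter> B = X0 \<inter> B" if "B \<in> P" "card B \<noteq> c" "y \<in> Ys" for y B
  proof -
    have "Z y \<inter> B = {}" using Z(1)[OF that(3)] that(1,2) part_unique unfolding size_class_def by blast
    then show ?thesis by (auto simp: X_def)
  qed
  have XV: "X y \<subseteq> V" if "y \<in> Ys" for y
  proof -
    have "X0 \<subseteq> V" using r Union_P unfolding X0_def by blast
    moreover have "Z y \<subseteq> V" using Z(1)[OF that] Union_P by (auto simp: size_class_def)
    ultimately show ?thesis by (simp add: X_def)
  qed
  have unequal: "\<exists>B\<in>size_class d. \<exists>C\<in>size_class d. card (X y \<inter> B) \<noteq> card (X y \<inter> C)"
    if y: "y \<in> Ys" and d: "card (size_class d) \<ge> 2" for y d
  proof (cases "d = c")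
    case True
    then show ?thesis using Z(3)[OF y] d by (simp add: X_c)
  next
    case False
    have "size_class d \<noteq> {}" using d by auto
    then have ds: "d \<in> sizes" by (auto simp: size_class_def sizes_def)
    then obtain B where B: "B \<in> size_class d" "r d \<in> B" using r by (auto simp: size_class_def)
    have "\<not> size_class d \<subseteq> {B}" using d card_mono[of "{B}" "size_class d"] by auto
    then obtain C where C: "C \<in> size_class d" "C \<noteq> B" by blast
    have "X y \<inter> B = X0 \<inter> B" "X y \<inter> C = X0 \<inter> C"
      using B C False y X_other by (auto simp: size_class_def simp del: Int_iff)
    moreover have "r d \<in> X0 \<inter> B" using ds False B by (auto simp: X0_def)
    moreover have "r d \<notin> C" using B C part_unique unfolding size_class_def by blast
    then have "X0 \<inter> C = {}" using X0_other[OF C(1)] by blast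
    moreover have "finite (X0 \<inter> B)" using B finite_part by (auto simp: size_class_def)
    ultimately have "card (X y \<inter> B) \<noteq> card (X y \<inter> C)" by auto
    then show ?thesis using B C by blast
  qed
  have mixed_part: "\<exists>C\<in>P. C \<inter> X y \<noteq> {} \<and> C - X y \<noteq> {}"
    if y: "y \<in> Ys" and B: "B \<in> P" "card B \<ge> 2" for y B
  proof -
    have "card B \<in> sizes" using B by (simp add: sizes_def)
    then have "sizes \<noteq> {1}" using B(2) by force
    then consider (other) e where "e \<in> sizes" "e \<noteq> c" "e \<ge> 2" | (ndvd) "\<not> c dvd y"
      using mixed y by blast
    then show ?thesis
    proof cases
      case other
      obtain C where C: "C \<in> P" "card C = e" "r e \<in> C" using r[OF other(1)] by blast
      have eq: "X y \<inter> C = X0 \<inter> C" using X_other C other y by simp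
      have "r e \<in> X0" using other by (simp add: X0_def)
      moreover have "\<not> C \<subseteq> {r e}" using C other card_mono[of "{r e}" C] by auto
      moreover have "X0 \<inter> C \<subseteq> {r e}" using X0_other[of C e] C(1,2) by (simp add: size_class_def)
      ultimately have "C \<inter> X y \<noteq> {}" "C - X y \<noteq> {}" using eq C by blast+
      then show ?thesis using C by blast
    next
      case ndvd
      then obtain B where B: "B \<in> size_class c" "B \<inter> Z y \<noteq> {}" "B - Z y \<noteq> {}"
        using exists_mixed_part[OF Z(1)[OF y]] Z(2)[OF y] by auto
      then have "B \<inter> X y \<noteq> {}" "B - X y \<noteq> {}" using X_c[OF B(1), of y] by blast+
      then show ?thesis using B by (auto simp: size_class_def)
    qed
  qed
  \<comment> \<open>All parts in class \<open>c\<close> have the same denominator, so only the size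
    of \<open>Z y\<close> matters and not its distribution.\<close>
  have split: "switched_secular (X y) k
      = (real (c * card (size_class c)) - 2 * real y) / (k + c)
        + (\<Sum>B\<in>P - size_class c. (real (card B) - 2 * real (card (X0 \<inter> B))) / (k + card B))"
    if y: "y \<in> Ys" for y k
  proof -
    let ?f = "\<lambda>A B. (real (card B) - 2 * real (card (A \<inter> B))) / (k + card B)"
    have QP: "size_class c \<subseteq> P" by (auto simp: size_class_def)
    have "switched_secular (X y) k = sum (?f (X y)) (P - size_class c) + sum (?f (X y)) (size_class c)"
      unfolding switched_secular_def by (rule sum.subset_diff[OF QP finite_P])
    moreover have "sum (?f (X y)) (P - size_class c) = sum (?f X0) (P - size_class c)"
      by (rule sum.cong) (use X_other y in \<open>auto simp: size_class_def\<close>)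
    moreover have "sum (?f (X y)) (size_class c)
        = (\<Sum>B\<in>size_class c. (real c - 2 * real (card (Z y \<inter> B))) / (k + c))"
      by (rule sum.cong) (use X_c in \<open>auto simp: size_class_def\<close>)
    moreover have "\<dots> = (real (c * card (size_class c)) - 2 * real (\<Sum>B\<in>size_class c. card (Z y \<inter> B))) / (k + c)"
      by (simp add: sum_divide_distrib[symmetric] sum_subtractf sum_distrib_left)
    moreover have "(\<Sum>B\<in>size_class c. card (Z y \<inter> B)) = y"
      using card_Union_parts[OF QP Z(1)[OF y]] Z(2)[OF y] by simp
    ultimately show ?thesis by simp
  qed
  have "\<exists>y\<in>Ys. \<forall>k\<in>secular_roots. switched_secular (X y) k \<noteq> 0"
  proof (rule ccontr)
    assume "\<not> ?thesis"
    \<comment> \<open>Pigeonhole: a root at which \<open>y\<close> fails is assigned to each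
      \<open>y\<close>; affinity in \<open>y\<close> makes the assignment injective.\<close>
    then obtain f where f: "\<And>y. y \<in> Ys \<Longrightarrow> f y \<in> secular_roots"
      "\<And>y. y \<in> Ys \<Longrightarrow> switched_secular (X y) (f y) = 0" by metis
    have "inj_on f Ys"
    proof (rule inj_onI)
      fix y y' assume yy: "y \<in> Ys" "y' \<in> Ys" "f y = f y'"
      have nz: "f y + c \<noteq> 0" using f(1)[OF yy(1)] c by (auto simp: secular_roots_def sizes_def)
      have "switched_secular (X y) (f y) = switched_secular (X y') (f y)"
        using f(2) yy by metis
      then show "y = y'" using nz by (simp add: split yy(1,2))
    qed
    moreover have "P \<noteq> {}" using c by (auto simp: sizes_def)
    ultimately have "card Ys \<le> card sizes"
      using card_inj_on_le[of f Ys secular_roots] f(1) finite_card_secular_roots by force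
    then show False using Ys by simp
  qed
  then obtain y where "y \<in> Ys" "\<forall>k\<in>secular_roots. switched_secular (X y) k \<noteq> 0" by blast
  then have "good (X y)" using XV unequal mixed_part by (auto simp: good_def)
  then show ?thesis by blast
qed

section \<open>Choice of the size class to vary\<close>

lemma card_V: "card V = (\<Sum>d\<in>sizes. d * card (size_class d))"
proof -
  have "card V = (\<Sum>B\<in>P. card (V \<inter> B))"
    using card_Union_parts[of P V] Union_P by simp
  also have "\<dots> = (\<Sum>B\<in>P. card B)"
    by (rule sum.cong) (use Union_P in \<open>auto intro!: arg_cong[of _ _ card]\<close>)
  also have "\<dots> = (\<Sum>d\<in>sizes. d * card (size_class d))"
    unfolding sum_over_classes by (rule sum.cong) (auto simp: size_class_def)
  finally show ?thesis .
qed

text \<open>The class of the largest size \<open>d\<close> is varied, except when it is too small to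
  offer enough values; then there are many singleton parts, and these are varied.\<close>

lemma exists_good:
  assumes V9: "card V \<ge> 9"
  shows "\<exists>X. good X"
proof -
  have ne: "sizes \<noteq> {}" using card_V V9 by auto
  define d where "d = Max sizes"
  define l where "l = card (size_class d)"
  have d: "d \<in> sizes" using ne finite_sizes by (simp add: d_def)
  have l1: "card (size_class e) \<ge> 1" if "e \<in> sizes" for e
    using that finite_P by (auto simp: sizes_def size_class_def Suc_le_eq card_gt_0_iff)
  have l: "l \<ge> 1" using l1[OF d] by (simp add: l_def)
  have sub: "sizes \<subseteq> {1..d}"
  proof
    fix e assume e: "e \<in> sizes"
    then have "e \<le> d" using finite_sizes by (simp add: d_def)
    then show "e \<in> {1..d}" using e card_part_pos by (auto simp: sizes_def Suc_le_eq)
  qed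
  then have s_le: "card sizes \<le> d" using card_mono[OF _ sub] by simp
  have d1: "d \<ge> 1" using d sub by auto
  consider (complete) "d = 1" | (repeated) "d \<ge> 2" "l \<ge> 2" "\<not> (d = 2 \<and> l = 2)"
    | (second) e where "l = 1" "e \<in> sizes" "2 \<le> e" "e < d"
    | (two_sizes) "d \<ge> 2" "sizes \<subseteq> {1, d}" "l = 1 \<or> (d = 2 \<and> l = 2)"
  proof -
    have "sizes \<subseteq> {1, d}" if "\<not> (\<exists>e\<in>sizes. 2 \<le> e \<and> e < d)" using that sub by force
    moreover have "sizes \<subseteq> {1, d}" if "d = 2" using that sub by force
    ultimately show thesis using that l d1
      by (metis One_nat_def Suc_1 le_antisym not_less_eq_eq)
  qed
  then show ?thesis
  proof cases
    case complete
    then have s: "sizes = {1}" using d sub by force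
    then have "card (size_class 1) \<ge> 9" using card_V V9 by simp
    then show ?thesis
      using s by (intro exists_good_varying_class[of 1 "{1..<9}"]) auto
  next
    case repeated
    \<comment> \<open>Non-multiples of \<open>d\<close> guarantee a split part within the class
      itself. There are at least \<open>d * l - l\<close> of them.\<close>
    define Ys where "Ys = {..<d * l} - (\<lambda>i. d * i) ` {..<l}"
    have ndvd: "\<not> d dvd y" "y < d * l" if "y \<in> Ys" for y
      using that by (auto simp: Ys_def elim!: dvdE)
    have "card Ys \<ge> card {..<d * l} - card ((\<lambda>i. d * i) ` {..<l})"
      unfolding Ys_def by (rule diff_card_le_card_Diff) simp
    moreover have "card ((\<lambda>i. d * i) ` {..<l}) \<le> l" using card_image_le[of "{..<l}"] by simp
    \<comment> \<open>Equivalent to \<open>(d - 1) * (l - 1) > 1\<close>, which is why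
      \<open>d = l = 2\<close> was set aside.\<close>
    moreover have "d * l > d + l"
    proof -
      obtain a b where "d = a + 2" "l = b + 2" using repeated by (metis add.commute le_Suc_ex)
      then show ?thesis using repeated(3) by (cases a; cases b) auto
    qed
    ultimately have big: "card Ys > card sizes" using s_le by simp
    have "0 < y" if "y \<in> Ys" for y using ndvd[OF that] by (cases y) auto
    then show ?thesis
      using big ndvd d
      by (intro exists_good_varying_class[of d Ys]) (auto simp: Ys_def l_def[symmetric] less_imp_le)
  next
    case second
    \<comment> \<open>A part of size \<open>e\<close> is split, and the single part of size
      \<open>d\<close> imposes no unevenness condition, so all \<open>d + 1\<close> values from
      \<open>0\<close> to \<open>d\<close> are allowed.\<close>
    then show ?thesis
      using d s_le by (intro exists_good_varying_class[of d "{..d}"]) (auto simp: l_def[symmetric])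
  next
    case two_sizes
    have s2: "card sizes \<le> 2"
      using card_mono[OF _ two_sizes(2)] two_sizes(1) by simp
    show ?thesis
    proof (cases "l = 1 \<and> d \<ge> 4")
      \<comment> \<open>The values \<open>1, ..., d - 1\<close> are not multiples of
        \<open>d\<close>, and there are at least three of them against at most two sizes.\<close>
      case True
      then show ?thesis using d s2
        by (intro exists_good_varying_class[of d "{1..<d}"])
          (auto simp: l_def[symmetric] nat_dvd_not_less)
    next
      case False
      \<comment> \<open>At most four vertices lie in the largest parts, which leaves at least five
        singletons and hence at least four values; the split part comes from size
        \<open>d\<close>.\<close>
      then have dl: "d * l \<le> 4" using two_sizes by auto
      have sum_sizes: "(\<Sum>e\<in>sizes. e * card (size_class e)) \<ge> 9" using card_V V9 by simp
      have "1 \<in> sizes"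
      proof (rule ccontr)
        assume "1 \<notin> sizes"
        then have "sizes = {d}" using two_sizes d by blast
        then show False using sum_sizes dl by (simp add: l_def)
      qed
      then have s: "sizes = {1, d}" using two_sizes d by blast
      then have "card (size_class 1) + d * l \<ge> 9"
        using sum_sizes two_sizes(1) by (simp add: l_def)
      then have "card (size_class 1) \<ge> 5" using dl by simp
      then show ?thesis
        using s s2 two_sizes(1)
        by (intro exists_good_varying_class[of 1 "{1..<card (size_class 1)}"]) auto
    qed
  qed
qed

end

section \<open>Transfer to the signed adjacency matrix\<close>

theorem theorem4p1:
  fixes vs :: "'v list" and E :: "'v set set"
    and s :: nat and l t :: "nat \<Rightarrow> nat"
  assumes "distinct vs"
    and "complete_multipartite (set vs) E s l t"
    and "card (set vs) \<ge> 9"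
    and "\<forall>i\<in>{1..s}. \<forall>j\<in>{1..s}. i < j \<longrightarrow> t i > t j"
    and "\<forall>i\<in>{1..s}. t i \<ge> 1"
    and "\<forall>i\<in>{1..s}. l i \<ge> 1"
  shows "\<exists>X \<subseteq> set vs. \<forall>k. eigenvalue (signed_adj_matrix vs E (switching_sign X)) k \<longrightarrow>
           main_eigenvalue (signed_adj_matrix vs E (switching_sign X)) k"
proof -
  obtain P where P: "partition_on (set vs) P"
    and E: "E = {{u, v} | u v. \<exists>B\<in>P. \<exists>C\<in>P. B \<noteq> C \<and> u \<in> B \<and> v \<in> C}"
    using assms(2) unfolding complete_multipartite_def by blast
  interpret vertex_partition "set vs" P by unfold_locales (use P in auto)
  obtain X where X: "good X" using exists_good assms(3) by blast
  define A where "A = signed_adj_matrix vs E (switching_sign X)"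
  let ?n = "length vs" and ?e = "switch X"
  have A: "A \<in> carrier_mat ?n ?n" by (simp add: A_def signed_adj_matrix_def)
  have edge: "{u, v} \<in> E \<longleftrightarrow> v \<notin> B" if "B \<in> P" "u \<in> B" "v \<in> set vs" for u v B
  proof
    assume "{u, v} \<in> E"
    then obtain a b B' C' where "{u, v} = {a, b}" "B' \<in> P" "C' \<in> P" "B' \<noteq> C'" "a \<in> B'" "b \<in> C'"
      unfolding E by blast
    then show "v \<notin> B" using that part_unique by (metis doubleton_eq_iff)
  next
    assume "v \<notin> B"
    moreover obtain C where "C \<in> P" "v \<in> C" using \<open>v \<in> set vs\<close> Union_P by blast
    ultimately show "{u, v} \<in> E" using that unfolding E by blast
  qed
  have sum_nth: "(\<Sum>i<?n. f (vs ! i)) = sum f (set vs)" for f :: "'v \<Rightarrow> real"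
    using sum.reindex_bij_betw[OF bij_betw_nth[OF assms(1) refl refl], of f] by (simp add: lessThan_def)
  \<comment> \<open>An edge \<open>{u, v}\<close> has sign \<open>?e u * ?e v\<close>, and
    \<open>?e v\<close> squares to 1, so \<open>A\<close> acts on \<open>?e * x\<close> as the
    unsigned adjacency matrix acts on \<open>x\<close>, up to the outer sign.\<close>
  have mult: "(A *\<^sub>v vec ?n (\<lambda>i. ?e (vs ! i) * x (vs ! i))) $ i
      = ?e (vs ! i) * (sum x (set vs) - sum x B)"
    if "i < ?n" "B \<in> P" "vs ! i \<in> B" for x i B
  proof -
    let ?u = "vs ! i"
    have entry: "(if {?u, v} \<in> E then switching_sign X {?u, v} else 0) * (?e v * x v)
        = ?e ?u * (x v - (if v \<in> B then x v else 0))" if v: "v \<in> set vs" for v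
      using edge[OF \<open>B \<in> P\<close> \<open>?u \<in> B\<close> v] \<open>?u \<in> B\<close> by (auto simp: switching_sign_def switch_def)
    have "(A *\<^sub>v vec ?n (\<lambda>i. ?e (vs ! i) * x (vs ! i))) $ i
        = (\<Sum>j<?n. (if {?u, vs ! j} \<in> E then switching_sign X {?u, vs ! j} else 0)
            * (?e (vs ! j) * x (vs ! j)))"
      using that(1) by (simp add: A_def signed_adj_matrix_def scalar_prod_def atLeast0LessThan)
    also have "\<dots> = (\<Sum>v\<in>set vs. (if {?u, v} \<in> E then switching_sign X {?u, v} else 0) * (?e v * x v))"
      by (rule sum_nth)
    also have "\<dots> = (\<Sum>v\<in>set vs. ?e ?u * (x v - (if v \<in> B then x v else 0)))"
      by (rule sum.cong) (use entry in auto)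
    also have "\<dots> = ?e ?u * (sum x (set vs) - (\<Sum>v\<in>set vs. if v \<in> B then x v else 0))"
      by (simp add: sum_distrib_left[symmetric] sum_subtractf)
    also have "(\<Sum>v\<in>set vs. if v \<in> B then x v else 0) = sum x B"
      using that(2) Union_P by (subst sum.If_cases) (auto intro!: arg_cong[of _ _ "sum x"])
    finally show ?thesis .
  qed
  have sq: "?e v * ?e v = 1" for v by (simp add: switch_def)
  have "main_eigenvalue A k" if ev: "eigenvalue A k" for k
  proof -
    obtain w where w: "w \<in> carrier_vec ?n" "w \<noteq> 0\<^sub>v ?n" "A *\<^sub>v w = k \<cdot>\<^sub>v w"
      using ev carrier_matD(1)[OF A] unfolding eigenvalue_def eigenvector_def by metis
    \<comment> \<open>Positions are recovered from vertices so that \<open>w\<close> can be read as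
      a function on the vertex set; \<open>x\<close> is that function with the signs undone.\<close>
    define idx where "idx = inv_into {..<?n} ((!) vs)"
    have idx: "idx (vs ! i) = i" if "i < ?n" for i
      unfolding idx_def using that assms(1) by (intro inv_into_f_f) (auto simp: inj_on_nth)
    define x where "x v = ?e v * w $ (idx v)" for v
    have wx: "w = vec ?n (\<lambda>i. ?e (vs ! i) * x (vs ! i))"
      using w(1) by (intro eq_vecI) (auto simp: x_def idx mult.assoc[symmetric] sq)
    obtain i0 where i0: "i0 < ?n" "w $ i0 \<noteq> 0"
      using w(1,2) by (metis carrier_vecD eq_vecI index_zero_vec(1) index_zero_vec(2))
    have "x (vs ! i0) \<noteq> 0" using i0 idx by (simp add: x_def switch_def)
    moreover have "eigenfunction x k"
      unfolding eigenfunction_def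
    proof (intro ballI)
      fix B u assume B: "B \<in> P" "u \<in> B"
      then have "u \<in> set vs" using Union_P by blast
      then obtain i where i: "i < ?n" "vs ! i = u" by (auto simp: in_set_conv_nth)
      have "?e u * (sum x (set vs) - sum x B) = (A *\<^sub>v w) $ i"
        using mult[of i B x] i B wx by simp
      also have "\<dots> = k * w $ i" using w i by simp
      also have "w $ i = ?e u * x u" by (subst wx) (simp add: i)
      also have "k * (?e u * x u) = ?e u * (k * x u)" by simp
      finally show "sum x (set vs) - sum x B = k * x u" by (simp add: switch_def split: if_splits)
    qed
    ultimately obtain y where y: "eigenfunction y k" "(\<Sum>v\<in>set vs. ?e v * y v) \<noteq> 0"
      using good_all_main[OF X] i0 nth_mem by metis
    \<comment> \<open>Putting the signs back turns the signed sum of \<open>y\<close> into the entry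
      sum of \<open>z\<close>.\<close>
    define z where "z = vec ?n (\<lambda>i. ?e (vs ! i) * y (vs ! i))"
    have zsum: "(\<Sum>i<dim_vec z. z $ i) \<noteq> 0"
      using y(2) sum_nth[of "\<lambda>v. ?e v * y v"] by (simp add: z_def)
    then have "z \<noteq> 0\<^sub>v ?n" by auto
    moreover have "A *\<^sub>v z = k \<cdot>\<^sub>v z"
    proof (rule eq_vecI)
      fix i assume "i < dim_vec (k \<cdot>\<^sub>v z)"
      then have i: "i < ?n" by (simp add: z_def)
      then obtain B where B: "B \<in> P" "vs ! i \<in> B" using Union_P nth_mem by blast
      have "sum y (set vs) - sum y B = k * y (vs ! i)"
        using y(1) B by (simp add: eigenfunction_def)
      then show "(A *\<^sub>v z) $ i = (k \<cdot>\<^sub>v z) $ i"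
        using mult[OF i B, of y] i by (simp add: z_def)
    qed (use A in \<open>simp add: z_def\<close>)
    ultimately have "eigenvector A z k"
      using A by (simp add: eigenvector_def z_def)
    then show ?thesis using zsum unfolding main_eigenvalue_def by blast
  qed
  moreover have "X \<subseteq> set vs" using X by (simp add: good_def)
  ultimately show ?thesis unfolding A_def by blast
qed

end
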